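(* Let $x,y$ be real numbers with $y\neq 0$, $x+y\neq 0$ and $x/(x+y)\geq 0$, let $n,p,r$ be positive integers and $m$ a nonnegative integer. Then \[ \sum_{k=0}^n x^ky^{n-k}\binom{n}{k}\, \zeta_k^\star(\{1\}_{p-1},m+2,\{1\}_{r-1}) =(x+y)^n \sum_{n\geq n_1\geq \cdots\geq n_{p+m+r}\geq 1} \frac{\left(\frac{y}{x+y}\right)^{n_p} \left(\frac{x+y}{y}\right)^{n_{p+m+1}}\left(1-\left(\frac{y}{x+y}\right)^{n_{p+m+r}}\right)}{n_1\cdots n_{p+m+r}}. \]
   Context: For a composition $\mathbf{k}=(k_1,\ldots,k_d)$ of positive integers and an integer $n\geq 0$, the multiple harmonic star sum is $\zeta^\star_n(\mathbf{k}):=\sum_{n\geq n_1\geq\cdots\geq n_d\geq 1} \frac{1}{n_1^{k_1}\cdots n_d^{k_d}}$ (equal to $0$ when $n=0$). Here $(\{1\}_{p-1},m+2,\{1\}_{r-1})$ denotes the composition consisting of $p-1$ ones, then $m+2$, then $r-1$ ones. The convention $0^0=1$ is used. *)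

theory Defs
  imports Complex_Main
begin

(* Index tuples n >= n_1 >= ... >= n_d >= 1. Lists are 0-based, so n_i is "ns ! (i - 1)". *)
definition star_chains :: "nat \<Rightarrow> nat \<Rightarrow> nat list set" where
  "star_chains n d = {ns. length ns = d \<and> set ns \<subseteq> {1..n} \<and> sorted_wrt (\<ge>) ns}"

lemma finite_star_chains: "finite (star_chains n d)"
  by (rule finite_subset[OF _ finite_lists_length_eq[of "{1..n}" d]])
     (auto simp: star_chains_def)

(* For a nonempty composition the value at n = 0 is an empty sum, hence 0
   (for the empty composition, which does not arise below, it would be 1). *)
definition zeta_star :: "nat \<Rightarrow> nat list \<Rightarrow> real" where
  "zeta_star n ks =
     (\<Sum>ns\<in>star_chains n (length ks). 1 / (\<Prod>i<length ks. real (ns ! i) ^ (ks ! i)))"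

lemma zeta_star_0: "ks \<noteq> [] \<Longrightarrow> zeta_star 0 ks = 0"
proof -
  assume "ks \<noteq> []"
  then have "star_chains 0 (length ks) = {}"
    by (auto simp: star_chains_def)
  then show ?thesis
    by (simp add: zeta_star_def)
qed

end

theory Submission
  imports Defs
begin

text \<open>
  Put \<open>t = x / (x + y)\<close> and \<open>s = 1 - t\<close>. Let \<open>S\<close> send \<open>f\<close> to \<open>\<Sum>j=1..n. f j / j\<close>, let \<open>D\<close> send
  \<open>f\<close> to \<open>f n / n\<close>, and let \<open>B\<close> be the binomial transform with weights \<open>t\<^sup>k s\<^sup>n\<^sup>-\<^sup>k (n choose k)\<close>.
  Pascal's rule and the absorption identity show that, on sequences vanishing at 0, \<open>B\<close> commutes
  with \<open>S\<close>, while \<open>B D = (s\<^sup>n S s\<^sup>-\<^sup>n) B\<close>. The star sum is \<open>S\<^sup>p D\<^sup>m\<^sup>+\<^sup>1 S\<^sup>r\<^sup>-\<^sup>1\<close> applied to the indicator of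
  \<open>n > 0\<close>, whose transform is \<open>1 - s\<^sup>n\<close>. Hence \<open>B\<close> turns it into
  \<open>S\<^sup>p s\<^sup>n S\<^sup>m\<^sup>+\<^sup>1 s\<^sup>-\<^sup>n S\<^sup>r\<^sup>-\<^sup>1 (1 - s\<^sup>n)\<close>, which is the right-hand side.
\<close>

text \<open>The weight is a parameter so that a chain sum with a different factor at each position
  becomes a \<open>foldr\<close> of these operators; both sides of the identity have this
  form.\<close>

definition weighted_sum :: "(nat \<Rightarrow> real) \<Rightarrow> (nat \<Rightarrow> real) \<Rightarrow> nat \<Rightarrow> real" where
  "weighted_sum w f n = (\<Sum>j=1..n. w j * f j)"

abbreviation harm_sum :: "(nat \<Rightarrow> real) \<Rightarrow> nat \<Rightarrow> real" where
  "harm_sum \<equiv> weighted_sum (\<lambda>j. 1 / real j)"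

definition div_index :: "(nat \<Rightarrow> real) \<Rightarrow> nat \<Rightarrow> real" where
  "div_index f n = f n / real n"

definition binomial_transform :: "real \<Rightarrow> (nat \<Rightarrow> real) \<Rightarrow> nat \<Rightarrow> real" where
  "binomial_transform t f n = (\<Sum>k\<le>n. real (n choose k) * t ^ k * (1 - t) ^ (n - k) * f k)"

definition twisted_harm_sum :: "real \<Rightarrow> (nat \<Rightarrow> real) \<Rightarrow> nat \<Rightarrow> real" where
  "twisted_harm_sum s f n = s ^ n * harm_sum (\<lambda>j. f j / s ^ j) n"

lemma weighted_sum_0 [simp]: "weighted_sum w f 0 = 0"
  by (simp add: weighted_sum_def)

lemma weighted_sum_Suc: "weighted_sum w f (Suc n) = weighted_sum w f n + w (Suc n) * f (Suc n)"
  by (simp add: weighted_sum_def)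

lemma weighted_sum_cong:
  assumes "\<And>j. j \<ge> 1 \<Longrightarrow> w j * f j = w' j * f' j"
  shows "weighted_sum w f = weighted_sum w' f'"
  using assms by (auto simp: weighted_sum_def intro!: sum.cong)

lemma div_index_0 [simp]: "div_index f 0 = 0"
  by (simp add: div_index_def)

lemma funpow_div_index: "(div_index ^^ k) f n = f n / real n ^ k"
  by (induction k) (auto simp: div_index_def)

subsection \<open>Chain sums as iterated sums\<close>

lemma star_chains_0: "star_chains n 0 = {[]}"
  by (auto simp: star_chains_def)

lemma star_chains_Suc:
  "star_chains n (Suc d) = (\<lambda>(j, ns). j # ns) ` (SIGMA j:{1..n}. star_chains j d)"
proof (intro equalityI subsetI)
  fix ns assume "ns \<in> star_chains n (Suc d)"
  then show "ns \<in> (\<lambda>(j, ns). j # ns) ` (SIGMA j:{1..n}. star_chains j d)"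
    by (cases ns) (auto simp: star_chains_def image_iff)
qed (force simp: star_chains_def)

lemma sum_star_chains_Suc:
  "(\<Sum>ns\<in>star_chains n (Suc d). F ns) = (\<Sum>j=1..n. \<Sum>ns\<in>star_chains j d. F (j # ns))"
proof -
  have "inj_on (\<lambda>(j, ns). j # ns) (SIGMA j:{1..n}. star_chains j d)"
    by (auto simp: inj_on_def)
  then show ?thesis
    by (simp add: star_chains_Suc sum.reindex sum.Sigma finite_star_chains split_def)
qed

text \<open>Using \<open>last (n # ns)\<close> instead of \<open>last ns\<close> makes the statement meaningful for empty \<open>ws\<close>.\<close>

lemma sum_star_chains_foldr:
  "(\<Sum>ns\<in>star_chains n (length ws). (\<Prod>i<length ws. (ws ! i) (ns ! i)) * h (last (n # ns)))
   = foldr weighted_sum ws h n"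
proof (induction ws arbitrary: n)
  case Nil
  then show ?case by (simp add: star_chains_0)
next
  case (Cons w ws)
  then show ?case
    \<comment> \<open>The last entry of \<open>n # j # ns\<close> is that of \<open>j # ns\<close>,
      so each inner sum is the induction hypothesis with bound \<open>j\<close>.\<close>
    by (simp add: sum_star_chains_Suc prod.lessThan_Suc_shift mult.assoc weighted_sum_def
        flip: sum_distrib_left del: last.simps prod.lessThan_Suc)
       (simp add: last_ConsR)
qed

text \<open>Chain entries are positive, so starting from the indicator of positive indices instead
  of the constant 1 changes nothing. It vanishes at 0, as commuting with the binomial transform
  requires.\<close>

lemma zeta_star_foldr:
  assumes "ks \<noteq> []"
  shows "zeta_star n ks
    = foldr weighted_sum (map (\<lambda>k j. 1 / real j ^ k) ks) (\<lambda>j. if j = 0 then 0 else 1) n"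
proof -
  have "(if last (n # ns) = 0 then 0 else 1 :: real) = 1"
    if "ns \<in> star_chains n (length ks)" for ns
  proof -
    from that assms have "ns \<noteq> []" and "set ns \<subseteq> {1..n}"
      by (auto simp: star_chains_def)
    then have "last ns \<in> {1..n}"
      using last_in_set by blast
    with \<open>ns \<noteq> []\<close> show ?thesis by simp
  qed
  then show ?thesis
    unfolding sum_star_chains_foldr[symmetric] zeta_star_def
    by (intro sum.cong) (simp_all add: prod_dividef del: last.simps)
qed

subsection \<open>The binomial transform\<close>

lemma binomial_transform_0 [simp]: "binomial_transform t f 0 = f 0"
  by (simp add: binomial_transform_def)

lemma binomial_transform_diff:
  "binomial_transform t (\<lambda>k. f k - g k) n = binomial_transform t f n - binomial_transform t g n"
  by (simp add: binomial_transform_def right_diff_distrib sum_subtractf)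

lemma binomial_transform_const: "binomial_transform t (\<lambda>_. c) n = c"
  using binomial_ring[of t "1 - t" n]
  by (simp add: binomial_transform_def flip: sum_distrib_right)

lemma binomial_transform_delta: "binomial_transform t (\<lambda>k. if k = 0 then c else 0) n = (1 - t) ^ n * c"
  by (simp add: binomial_transform_def if_distrib[of "\<lambda>u. _ * u"] sum.delta cong: if_cong)

text \<open>By Pascal's rule the parts with \<open>n choose k\<close> give the transform of the
  shifted sequence; those with \<open>n choose Suc k\<close>, joined by the term at index 0, restore
  the transform at \<open>n\<close>.\<close>

lemma binomial_transform_Suc:
  "binomial_transform t f (Suc n)
   = (1 - t) * binomial_transform t f n + t * binomial_transform t (\<lambda>k. f (Suc k)) n"
proof -
  let ?s = "1 - t"
  \<comment> \<open>The term \<open>k = n\<close> has coefficient 0. Without it \<open>n - k\<close>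
    is positive, so a factor \<open>1 - t\<close> can be pulled out despite truncated
    subtraction.\<close>
  have "(\<Sum>k\<le>n. real (n choose Suc k) * t ^ Suc k * ?s ^ (n - k) * f (Suc k))
      = (\<Sum>k<n. real (n choose Suc k) * t ^ Suc k * ?s ^ (n - k) * f (Suc k))"
    by (simp add: lessThan_Suc_atMost[symmetric])
  also have "\<dots> = ?s * (\<Sum>k<n. real (n choose Suc k) * t ^ Suc k * ?s ^ (n - Suc k) * f (Suc k))"
    unfolding sum_distrib_left
  proof (intro sum.cong refl)
    fix k assume "k \<in> {..<n}"
    then have "n - k = Suc (n - Suc k)" by simp
    then show "real (n choose Suc k) * t ^ Suc k * ?s ^ (n - k) * f (Suc k)
        = ?s * (real (n choose Suc k) * t ^ Suc k * ?s ^ (n - Suc k) * f (Suc k))"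
      by simp
  qed
  finally have *: "(\<Sum>k\<le>n. real (n choose Suc k) * t ^ Suc k * ?s ^ (n - k) * f (Suc k))
      = ?s * (binomial_transform t f n - ?s ^ n * f 0)"
    by (simp add: binomial_transform_def sum.atMost_shift)
  have "binomial_transform t f (Suc n) = ?s ^ Suc n * f 0
      + (\<Sum>k\<le>n. real (n choose Suc k) * t ^ Suc k * ?s ^ (n - k) * f (Suc k))
      + t * binomial_transform t (\<lambda>k. f (Suc k)) n"
    by (simp add: binomial_transform_def sum.atMost_Suc_shift sum_distrib_left
        sum.distrib[symmetric] algebra_simps del: sum.atMost_Suc)
  then show ?thesis
    unfolding * by (simp add: algebra_simps)
qed

text \<open>Absorption moves the factor \<open>Suc n\<close> onto the index of the sequence; the
  extra term at index 0 is killed by its factor \<open>real k\<close>.\<close>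

lemma binomial_transform_absorb:
  "real (Suc n) * (t * binomial_transform t (\<lambda>k. f (Suc k)) n)
   = binomial_transform t (\<lambda>k. real k * f k) (Suc n)"
proof -
  have *: "real (Suc n) * (t * (real (n choose k) * t ^ k * (1 - t) ^ (n - k) * f (Suc k)))
      = real (Suc n choose Suc k) * t ^ Suc k * (1 - t) ^ (n - k) * (real (Suc k) * f (Suc k))" for k
  proof -
    have "real (Suc n) * real (n choose k) = real (Suc n choose Suc k) * real (Suc k)"
      using Suc_times_binomial_eq[of n k] by (metis of_nat_mult)
    then have "real (Suc n) * real (n choose k) * (t ^ Suc k * (1 - t) ^ (n - k) * f (Suc k))
        = real (Suc n choose Suc k) * real (Suc k) * (t ^ Suc k * (1 - t) ^ (n - k) * f (Suc k))"
      by (rule arg_cong)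
    then show ?thesis
      by (simp only: power_Suc mult_ac)
  qed
  show ?thesis
    unfolding binomial_transform_def sum.atMost_Suc_shift sum_distrib_left *
    by (simp del: of_nat_Suc binomial_Suc_Suc)
qed

lemma binomial_transform_harm_sum:
  assumes "f 0 = 0"
  shows "binomial_transform t (harm_sum f) = harm_sum (binomial_transform t f)"
proof
  fix n show "binomial_transform t (harm_sum f) n = harm_sum (binomial_transform t f) n"
  proof (induction n)
    case 0
    then show ?case by simp
  next
    case (Suc n)
    let ?g = "harm_sum f"
    let ?d = "\<lambda>k. ?g k - ?g (k - 1)"
    \<comment> \<open>At \<open>k = 0\<close> the left side is 0, which is where
      \<open>f 0 = 0\<close> enters.\<close>
    have d: "real k * ?d k = f k" for k
      using assms by (cases k) (simp_all add: weighted_sum_Suc)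
    have "binomial_transform t ?g (Suc n)
        = binomial_transform t ?g n + t * binomial_transform t (\<lambda>k. ?d (Suc k)) n"
      by (simp add: binomial_transform_Suc binomial_transform_diff algebra_simps)
    moreover have "t * binomial_transform t (\<lambda>k. ?d (Suc k)) n
        = binomial_transform t f (Suc n) / real (Suc n)"
      using binomial_transform_absorb[of n t ?d] unfolding d
      by (simp add: field_simps del: of_nat_Suc)
    ultimately show ?case
      using Suc by (simp add: weighted_sum_Suc)
  qed
qed

text \<open>With \<open>u\<close> the left side and \<open>s = 1 - t\<close>, Pascal and absorption
  give \<open>u (Suc n) = s * u n + binomial_transform t f (Suc n) / Suc n\<close>. The twisted sum
  solves this recurrence by variation of constants, dividing by powers of \<open>s\<close>.\<close>

lemma binomial_transform_div_index:
  assumes "f 0 = 0" and "t \<noteq> 1"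
  shows "binomial_transform t (div_index f) = twisted_harm_sum (1 - t) (binomial_transform t f)"
proof
  fix n
  show "binomial_transform t (div_index f) n = twisted_harm_sum (1 - t) (binomial_transform t f) n"
  proof (induction n)
    case 0
    then show ?case by (simp add: twisted_harm_sum_def)
  next
    case (Suc n)
    have d: "real k * div_index f k = f k" for k
      using assms(1) by (cases "k = 0") (simp_all add: div_index_def)
    have "t * binomial_transform t (\<lambda>k. div_index f (Suc k)) n
        = binomial_transform t f (Suc n) / real (Suc n)"
      using binomial_transform_absorb[of n t "div_index f"] unfolding d
      by (simp add: field_simps del: of_nat_Suc)
    then show ?case
      using Suc assms(2)
      by (simp add: binomial_transform_Suc[of t "div_index f"] twisted_harm_sum_def
          weighted_sum_Suc distrib_left del: of_nat_Suc)
  qed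
qed

lemma funpow_harm_sum_0:
  assumes "f 0 = 0"
  shows "(harm_sum ^^ k) f 0 = 0"
  using assms by (cases k) simp_all

lemma binomial_transform_funpow_harm_sum:
  assumes "f 0 = 0"
  shows "binomial_transform t ((harm_sum ^^ k) f) = (harm_sum ^^ k) (binomial_transform t f)"
  by (induction k) (simp_all add: binomial_transform_harm_sum funpow_harm_sum_0 assms)

lemma binomial_transform_funpow_div_index:
  assumes "f 0 = 0" and "t \<noteq> 1"
  shows "binomial_transform t ((div_index ^^ k) f)
    = (twisted_harm_sum (1 - t) ^^ k) (binomial_transform t f)"
proof (induction k)
  case (Suc k)
  have "(div_index ^^ k) f 0 = 0"
    using assms(1) by (simp add: funpow_div_index)
  with Suc show ?case
    using assms(2) by (simp add: binomial_transform_div_index)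
qed simp

text \<open>The operator is a conjugate of \<open>harm_sum\<close>, so the inner powers of
  \<open>s\<close> cancel under iteration.\<close>

lemma funpow_twisted_harm_sum:
  assumes "s \<noteq> 0"
  shows "(twisted_harm_sum s ^^ k) f = (\<lambda>n. s ^ n * (harm_sum ^^ k) (\<lambda>j. f j / s ^ j) n)"
  using assms by (induction k) (simp_all add: twisted_harm_sum_def fun_eq_iff)

section \<open>Both sides as iterated harmonic sums\<close>

lemma binomial_transform_zeta_star:
  assumes "t \<noteq> 1"
  shows "binomial_transform t (\<lambda>k. zeta_star k (replicate a 1 @ [m + 2] @ replicate b 1)) n
    = (harm_sum ^^ Suc a) (\<lambda>j. (1 - t) ^ j
        * (harm_sum ^^ Suc m) (\<lambda>i. (harm_sum ^^ b) (\<lambda>l. 1 - (1 - t) ^ l) i / (1 - t) ^ i) j) n"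
proof -
  define h :: "nat \<Rightarrow> real" where "h = (\<lambda>j. if j = 0 then 0 else 1)"
  let ?f = "(harm_sum ^^ b) h"
  have f0: "?f 0 = 0"
    by (rule funpow_harm_sum_0) (simp add: h_def)
  have df0: "(div_index ^^ Suc m) ?f 0 = 0"
    by simp
  have h: "binomial_transform t h = (\<lambda>n. 1 - (1 - t) ^ n)"
  proof -
    have *: "h = (\<lambda>j. 1 - (if j = 0 then 1 else 0))"
      by (auto simp: h_def)
    show ?thesis
      unfolding * by (simp add: binomial_transform_diff binomial_transform_const
          binomial_transform_delta fun_eq_iff)
  qed
  have "(\<lambda>k. zeta_star k (replicate a 1 @ [m + 2] @ replicate b 1))
      = (harm_sum ^^ a) (weighted_sum (\<lambda>j. 1 / real j ^ (m + 2)) ?f)"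
    by (simp add: fun_eq_iff zeta_star_foldr h_def foldr_replicate)
  \<comment> \<open>One of the \<open>m + 2\<close> powers of \<open>1 / j\<close> serves as the
    weight of the outer sum; the others become \<open>Suc m\<close> divisions.\<close>
  also have "weighted_sum (\<lambda>j. 1 / real j ^ (m + 2)) ?f = harm_sum ((div_index ^^ Suc m) ?f)"
    by (intro weighted_sum_cong) (simp add: funpow_div_index del: funpow.simps)
  finally have "(\<lambda>k. zeta_star k (replicate a 1 @ [m + 2] @ replicate b 1))
      = (harm_sum ^^ Suc a) ((div_index ^^ Suc m) ?f)"
    by (simp only: funpow_Suc_right comp_apply)
  then have "binomial_transform t (\<lambda>k. zeta_star k (replicate a 1 @ [m + 2] @ replicate b 1))
      = (harm_sum ^^ Suc a) ((twisted_harm_sum (1 - t) ^^ Suc m) (binomial_transform t ?f))"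
    by (simp only: binomial_transform_funpow_harm_sum[of "(div_index ^^ Suc m) ?f", OF df0]
        binomial_transform_funpow_div_index[of ?f, OF f0 assms])
  also have "binomial_transform t ?f = (harm_sum ^^ b) (\<lambda>l. 1 - (1 - t) ^ l)"
    by (subst binomial_transform_funpow_harm_sum) (simp_all only: h, simp add: h_def)
  finally show ?thesis
    using assms by (simp only: funpow_twisted_harm_sum)
qed

lemma sum_star_chains_twisted:
  fixes s :: real
  assumes "p \<ge> 1" and "r \<ge> 1"
  shows "(\<Sum>ns\<in>star_chains n (p + m + r).
      s ^ (ns ! (p - 1)) * (1 / s) ^ (ns ! (p + m)) * (1 - s ^ (ns ! (p + m + r - 1)))
      / (\<Prod>i<p + m + r. real (ns ! i)))
    = (harm_sum ^^ p) (\<lambda>j. s ^ j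
        * (harm_sum ^^ Suc m) (\<lambda>i. (harm_sum ^^ (r - 1)) (\<lambda>l. 1 - s ^ l) i / s ^ i) j) n"
proof -
  let ?inv = "\<lambda>j::nat. 1 / real j"
  \<comment> \<open>Every position contributes \<open>1 / j\<close>; the 0-based positions
    \<open>p - 1\<close> and \<open>p + m\<close> also carry the powers of \<open>s\<close> and
    \<open>1 / s\<close>. The factor in the last entry becomes the function the fold starts
    from.\<close>
  define ws where "ws = replicate (p - 1) ?inv @ [\<lambda>j. s ^ j / real j] @ replicate m ?inv
    @ [\<lambda>j. (1 / s) ^ j / real j] @ replicate (r - 1) ?inv"
  have len: "length ws = p + m + r"
    using assms by (simp add: ws_def)
  have nth: "(ws ! i) j = (if i = p - 1 then s ^ j else 1) * (if i = p + m then (1 / s) ^ j else 1)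
      / real j" if "i < p + m + r" for i j
    using that assms by (auto simp: ws_def nth_append nth_Cons')
  have "s ^ (ns ! (p - 1)) * (1 / s) ^ (ns ! (p + m)) * (1 - s ^ (ns ! (p + m + r - 1)))
      / (\<Prod>i<p + m + r. real (ns ! i))
    = (\<Prod>i<p + m + r. (ws ! i) (ns ! i)) * (1 - s ^ last (n # ns))"
    if "ns \<in> star_chains n (p + m + r)" for ns
  proof -
    have "length ns = p + m + r" "ns \<noteq> []"
      using that assms by (auto simp: star_chains_def)
    then have "last (n # ns) = ns ! (p + m + r - 1)"
      by (simp add: last_conv_nth)
    \<comment> \<open>Both special positions are in range, so each conditional product collapses to
      a single factor.\<close>
    moreover have "p - 1 < p + m + r" "p + m < p + m + r"
      using assms by simp_all
    then have "(\<Prod>i<p + m + r. (ws ! i) (ns ! i))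
        = s ^ (ns ! (p - 1)) * (1 / s) ^ (ns ! (p + m)) / (\<Prod>i<p + m + r. real (ns ! i))"
      by (simp add: nth prod_dividef prod.distrib prod.delta del: One_nat_def)
    ultimately show ?thesis by simp
  qed
  then have "(\<Sum>ns\<in>star_chains n (p + m + r).
      s ^ (ns ! (p - 1)) * (1 / s) ^ (ns ! (p + m)) * (1 - s ^ (ns ! (p + m + r - 1)))
      / (\<Prod>i<p + m + r. real (ns ! i)))
    = foldr weighted_sum ws (\<lambda>l. 1 - s ^ l) n"
    unfolding sum_star_chains_foldr[symmetric] len by (intro sum.cong refl)
  also have "\<dots> = (harm_sum ^^ (p - 1)) (weighted_sum (\<lambda>j. s ^ j / real j) ((harm_sum ^^ m)
      (weighted_sum (\<lambda>j. (1 / s) ^ j / real j) ((harm_sum ^^ (r - 1)) (\<lambda>l. 1 - s ^ l))))) n"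
    by (simp add: ws_def foldr_replicate)
  \<comment> \<open>Moving the powers of \<open>s\<close> into the arguments leaves plain harmonic
    sums, which merge with their neighbours into blocks of \<open>p\<close> and
    \<open>Suc m\<close>.\<close>
  also have "weighted_sum (\<lambda>j. (1 / s) ^ j / real j) f = harm_sum (\<lambda>i. f i / s ^ i)" for f
    by (intro weighted_sum_cong) (simp add: power_one_over field_simps)
  also have "weighted_sum (\<lambda>j. s ^ j / real j) f = harm_sum (\<lambda>j. s ^ j * f j)" for f
    by (intro weighted_sum_cong) simp
  also have "(harm_sum ^^ (p - 1)) (harm_sum f) = (harm_sum ^^ p) f" for f
    using assms(1) by (metis Suc_pred' comp_apply funpow_Suc_right less_eq_Suc_le One_nat_def)
  finally show ?thesis
    by (simp only: funpow_Suc_right comp_apply)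
qed

theorem theorem1p3:
  fixes x y :: real and n p r m :: nat
  assumes "y \<noteq> 0" and "x + y \<noteq> 0" and "x / (x + y) \<ge> 0"
    and "n \<ge> 1" and "p \<ge> 1" and "r \<ge> 1"
  shows "(\<Sum>k=0..n. x ^ k * y ^ (n - k) * real (n choose k) *
            zeta_star k (replicate (p - 1) 1 @ [m + 2] @ replicate (r - 1) 1))
       = (x + y) ^ n *
         (\<Sum>ns\<in>star_chains n (p + m + r).
            (y / (x + y)) ^ (ns ! (p - 1)) * ((x + y) / y) ^ (ns ! (p + m)) *
            (1 - (y / (x + y)) ^ (ns ! (p + m + r - 1)))
            / (\<Prod>i<p + m + r. real (ns ! i)))"
proof -
  define t s where "t = x / (x + y)" and "s = y / (x + y)"
  have s: "1 - t = s" and "s \<noteq> 0" and inv: "(x + y) / y = 1 / s"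
    using assms(1,2) by (simp_all add: t_def s_def field_simps)
  then have "t \<noteq> 1" by auto
  let ?z = "\<lambda>k. zeta_star k (replicate (p - 1) 1 @ [m + 2] @ replicate (r - 1) 1)"
  \<comment> \<open>The weights are homogeneous of degree \<open>n\<close>, so extracting
    \<open>(x + y) ^ n\<close> normalises them to sum 1.\<close>
  have "x ^ k * y ^ (n - k) = (x + y) ^ n * (t ^ k * s ^ (n - k))" if "k \<le> n" for k
  proof -
    have "(x + y) ^ n = (x + y) ^ k * (x + y) ^ (n - k)"
      using that by (simp flip: power_add)
    then show ?thesis
      using assms(2) by (simp add: t_def s_def power_divide)
  qed
  then have "(\<Sum>k=0..n. x ^ k * y ^ (n - k) * real (n choose k) * ?z k)
      = (x + y) ^ n * binomial_transform t ?z n"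
    unfolding binomial_transform_def s sum_distrib_left atMost_atLeast0
    by (intro sum.cong) (simp_all add: mult_ac)
  also have "binomial_transform t ?z n = (\<Sum>ns\<in>star_chains n (p + m + r).
      s ^ (ns ! (p - 1)) * (1 / s) ^ (ns ! (p + m)) * (1 - s ^ (ns ! (p + m + r - 1)))
      / (\<Prod>i<p + m + r. real (ns ! i)))"
    using assms(5,6) by (simp only: binomial_transform_zeta_star[OF \<open>t \<noteq> 1\<close>] s
        sum_star_chains_twisted) simp
  finally show ?thesis
    unfolding inv s_def .
qed

end
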